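(* Let $H$ be a connected graph, $G$ a finite graph, and $k$ a positive integer. Maker wins the $H$-game on $G$ in at most $k$ moves if and only if there exists an edge $e\in E(G)$ such that Maker wins the $H$-game on $G[B_G(e,3^k)]$ in at most $k$ moves.
   Context: In a Maker-Breaker game on the edge set of a graph $G$, Maker and Breaker alternately claim previously unclaimed edges of $G$, Maker first. In the $H$-game the winning sets are all $F\subseteq E(G)$ such that the edge-induced subgraph $G[F]$ (edge set $F$, vertex set the endpoints of edges of $F$) is isomorphic to $H$. Maker wins in at most $k$ moves if she has a strategy guaranteeing that, among her first $k$ claimed edges, she has claimed all edges of some winning set, whatever Breaker does. For an edge $e=uv$ of $G$ and $r\in\mathbb{N}$, $B_G(e,r)=\{ww'\in E(G)\mid \max\{dist_G(u,w),dist_G(v,w),dist_G(u,w'),dist_G(v,w')\}\le r\}$, where $dist_G$ is the shortest-path distance in $G$; $G[B_G(e,r)]$ denotes the edge-induced subgraph on this edge set. *)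

theory Defs
  imports Main "HOL-Library.Extended_Nat"
begin

record 'v ugraph =
  verts :: "'v set"
  edges :: "'v set set"

definition simple_graph :: "'v ugraph \<Rightarrow> bool" where
  "simple_graph G \<longleftrightarrow> (\<forall>e\<in>edges G. e \<subseteq> verts G \<and> card e = 2)"

definition finite_graph :: "'v ugraph \<Rightarrow> bool" where
  "finite_graph G \<longleftrightarrow> simple_graph G \<and> finite (verts G)"

definition walk_betw :: "'v ugraph \<Rightarrow> 'v \<Rightarrow> 'v list \<Rightarrow> 'v \<Rightarrow> bool" where
  "walk_betw G u p v \<longleftrightarrow> p \<noteq> [] \<and> hd p = u \<and> last p = v \<and> set p \<subseteq> verts G \<and>
     successively (\<lambda>x y. {x, y} \<in> edges G) p"

text \<open>Connected graphs are nonempty.\<close>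

definition connected_graph :: "'v ugraph \<Rightarrow> bool" where
  "connected_graph G \<longleftrightarrow> simple_graph G \<and> verts G \<noteq> {} \<and>
     (\<forall>u\<in>verts G. \<forall>v\<in>verts G. \<exists>p. walk_betw G u p v)"

text \<open>A walk is given by its list of vertices, so its length is one less than that of the
  list. The distance of vertices in different components is \<open>\<infinity>\<close>, the infimum of the empty
  set.\<close>

definition graph_dist :: "'v ugraph \<Rightarrow> 'v \<Rightarrow> 'v \<Rightarrow> enat" where
  "graph_dist G u v = (INF p\<in>{p. walk_betw G u p v}. enat (length p - 1))"

definition isomorphic :: "'v ugraph \<Rightarrow> 'w ugraph \<Rightarrow> bool" where
  "isomorphic G H \<longleftrightarrow> (\<exists>f. bij_betw f (verts G) (verts H) \<and>
     (\<forall>u\<in>verts G. \<forall>v\<in>verts G. {u, v} \<in> edges G \<longleftrightarrow> {f u, f v} \<in> edges H))"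

text \<open>The subgraph induced by a set \<open>F\<close> of edges of a graph depends only on \<open>F\<close>.\<close>

definition edge_induced :: "'v set set \<Rightarrow> 'v ugraph" where
  "edge_induced F = \<lparr>verts = \<Union>F, edges = F\<rparr>"

definition edge_ball :: "'v ugraph \<Rightarrow> 'v set \<Rightarrow> nat \<Rightarrow> 'v set set" where
  "edge_ball G e r = {f\<in>edges G. \<forall>x\<in>e. \<forall>y\<in>f. graph_dist G x y \<le> enat r}"

text \<open>Maker-Breaker games on a board \<open>X\<close>. A play is the list of the elements claimed so far,
  in order; Maker moves first, so her elements are those at the even positions \<open>0, 2, 4, \<dots>\<close>.
  A strategy for Maker maps the play so far to her next move.\<close>

definition play :: "'e set \<Rightarrow> 'e list \<Rightarrow> bool" where
  "play X p \<longleftrightarrow> distinct p \<and> set p \<subseteq> X"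

definition follows :: "('e list \<Rightarrow> 'e) \<Rightarrow> 'e list \<Rightarrow> bool" where
  "follows \<sigma> p \<longleftrightarrow> (\<forall>i<length p. even i \<longrightarrow> p ! i = \<sigma> (take i p))"

text \<open>Whenever it is Maker's turn and the board is not exhausted, the strategy must
  prescribe an unclaimed element.\<close>

definition maker_strategy :: "'e set \<Rightarrow> ('e list \<Rightarrow> 'e) \<Rightarrow> bool" where
  "maker_strategy X \<sigma> \<longleftrightarrow> (\<forall>p. play X p \<and> follows \<sigma> p \<and> even (length p) \<and> set p \<noteq> X
     \<longrightarrow> \<sigma> p \<in> X - set p)"

definition maker_claims :: "nat \<Rightarrow> 'e list \<Rightarrow> 'e set" where
  "maker_claims k p = {p ! (2 * i) | i. i < k \<and> 2 * i < length p}"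

text \<open>The condition is imposed on complete plays, in which all of the board is claimed; if Maker
  makes fewer than \<open>k\<close> moves in such a play, then \<open>maker_claims k p\<close> is the set of all her
  elements. On an infinite board there are no complete plays, so \<open>X\<close> is meant to be finite.\<close>

definition maker_wins_within :: "'e set \<Rightarrow> 'e set set \<Rightarrow> nat \<Rightarrow> bool" where
  "maker_wins_within X W k \<longleftrightarrow> (\<exists>\<sigma>. maker_strategy X \<sigma> \<and>
     (\<forall>p. play X p \<and> set p = X \<and> follows \<sigma> p \<longrightarrow> (\<exists>F\<in>W. F \<subseteq> maker_claims k p)))"

definition winning_sets :: "'w ugraph \<Rightarrow> 'v ugraph \<Rightarrow> 'v set set set" where
  "winning_sets H G = {F. F \<subseteq> edges G \<and> isomorphic (edge_induced F) H}"

definition maker_wins_graph_game :: "'w ugraph \<Rightarrow> 'v ugraph \<Rightarrow> nat \<Rightarrow> bool" where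
  "maker_wins_graph_game H G k \<longleftrightarrow> maker_wins_within (edges G) (winning_sets H G) k"

end

theory Submission
  imports Defs
begin

text \<open>
  Locality is proved by induction on the number \<open>j\<close> of moves that Maker has left, with radius
  \<open>2\<^sup>j k\<close>. Let \<open>x\<close> be her next move in a winning strategy. For every reply of Breaker
  (passing included) the resulting position is, by induction, won inside a ball of radius
  \<open>2\<^sup>j\<^sup>-\<^sup>1 k\<close>. If one of these balls misses \<open>x\<close>, then the move \<open>x\<close> was superfluous and Maker
  already wins inside that ball. Otherwise all of these balls contain \<open>x\<close>, hence lie in the ball
  of twice the radius around \<open>x\<close>, inside which Maker wins starting with \<open>x\<close>. When no moves are
  left, Maker owns a connected winning set with at most \<open>k\<close> edges, which lies in the ball of
  radius \<open>k\<close> around each of its edges. Finally \<open>2\<^sup>k k \<le> 3\<^sup>k\<close>.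
\<close>

section \<open>Positions of a Maker-Breaker game\<close>

text \<open>Maker, to move, owns \<open>M\<close>, and \<open>U\<close> is the set of unclaimed elements. Breaker's reply \<open>y\<close>
  is arbitrary; a reply outside \<open>U - {x}\<close>, such as \<open>y = x\<close>, amounts to passing.\<close>

fun maker_forces :: "'e set set \<Rightarrow> nat \<Rightarrow> 'e set \<Rightarrow> 'e set \<Rightarrow> bool" where
  "maker_forces W 0 M U \<longleftrightarrow> (\<exists>F\<in>W. F \<subseteq> M)"
| "maker_forces W (Suc k) M U \<longleftrightarrow>
     (\<exists>F\<in>W. F \<subseteq> M) \<or> (\<exists>x\<in>U. \<forall>y. maker_forces W k (insert x M) (U - {x, y}))"

lemma maker_forces_won: "F \<in> W \<Longrightarrow> F \<subseteq> M \<Longrightarrow> maker_forces W k M U"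
  by (cases k) auto

text \<open>Maker copies her move from the smaller position; a reply of Breaker outside
  \<open>U\<close> counts there as a pass.\<close>

lemma maker_forces_mono:
  assumes "maker_forces W k M U" "M \<subseteq> M'" "U \<subseteq> U'"
  shows "maker_forces W k M' U'"
  using assms
proof (induction k arbitrary: M U M' U')
  case 0
  then show ?case by auto
next
  case (Suc k)
  show ?case
  proof (cases "\<exists>F\<in>W. F \<subseteq> M")
    case True
    then show ?thesis using Suc.prems by auto
  next
    case False
    then obtain x where x: "x \<in> U" "\<And>y. maker_forces W k (insert x M) (U - {x, y})"
      using Suc.prems by auto
    have "maker_forces W k (insert x M') (U' - {x, y})" for y
      by (rule Suc.IH[OF x(2)[of y]]) (use Suc.prems in auto)
    then show ?thesis
      unfolding maker_forces.simps using x(1) Suc.prems(3) by blast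
  qed
qed

lemma maker_forces_Suc: "maker_forces W k M U \<Longrightarrow> maker_forces W (Suc k) M U"
proof (induction k arbitrary: M U)
  case 0
  then show ?case by simp
next
  case (Suc k)
  show ?case
  proof (cases "\<exists>F\<in>W. F \<subseteq> M")
    case True
    then show ?thesis by auto
  next
    case False
    then obtain x where "x \<in> U" "\<And>y. maker_forces W k (insert x M) (U - {x, y})"
      using Suc.prems by auto
    then have "\<exists>x\<in>U. \<forall>y. maker_forces W (Suc k) (insert x M) (U - {x, y})"
      using Suc.IH by blast
    then show ?thesis unfolding maker_forces.simps(2)[of W "Suc k"] by blast
  qed
qed

text \<open>Maker never owns anything outside \<open>M \<union> U\<close>, so only winning sets
  inside \<open>B\<close> matter. This lets the game on a ball be judged by the winning sets of the
  whole graph.\<close>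

lemma maker_forces_change_sets:
  assumes "maker_forces W k M U" "M \<union> U \<subseteq> B" "{F \<in> W. F \<subseteq> B} \<subseteq> W'"
  shows "maker_forces W' k M U"
  using assms
proof (induction k arbitrary: M U)
  case 0
  then show ?case by auto
next
  case (Suc k)
  show ?case
  proof (cases "\<exists>F\<in>W. F \<subseteq> M")
    case True
    then obtain F where "F \<in> W" "F \<subseteq> M" by blast
    moreover have "F \<in> W'" using Suc.prems \<open>F \<in> W\<close> \<open>F \<subseteq> M\<close> by blast
    ultimately show ?thesis using maker_forces_won by blast
  next
    case False
    then obtain x where x: "x \<in> U" "\<And>y. maker_forces W k (insert x M) (U - {x, y})"
      using Suc.prems by auto
    have "maker_forces W' k (insert x M) (U - {x, y})" for y
      by (rule Suc.IH[OF x(2)[of y]]) (use Suc.prems x in auto)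
    then show ?thesis using x by auto
  qed
qed

section \<open>Strategies and positions\<close>

lemma maker_claims_short:
  assumes "length q \<le> 2 * n" "n \<le> k"
  shows "maker_claims k q = maker_claims n q"
proof -
  have "i < k \<and> 2 * i < length q \<longleftrightarrow> i < n \<and> 2 * i < length q" for i
    using assms by auto
  then show ?thesis
    unfolding maker_claims_def by simp
qed

lemma maker_claims_append:
  assumes "length q = 2 * n"
  shows "maker_claims n (q @ r) = maker_claims n q"
  unfolding maker_claims_def
proof (intro Collect_cong iffI; elim exE)
  fix z i
  assume "z = (q @ r) ! (2 * i) \<and> i < n \<and> 2 * i < length (q @ r)"
  then show "\<exists>i. z = q ! (2 * i) \<and> i < n \<and> 2 * i < length q"
    using assms by (intro exI[of _ i]) (auto simp: nth_append)
next
  fix z i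
  assume "z = q ! (2 * i) \<and> i < n \<and> 2 * i < length q"
  then show "\<exists>i. z = (q @ r) ! (2 * i) \<and> i < n \<and> 2 * i < length (q @ r)"
    using assms by (intro exI[of _ i]) (auto simp: nth_append)
qed

lemma maker_claims_Suc:
  assumes "2 * n < length p"
  shows "maker_claims (Suc n) p = insert (p ! (2 * n)) (maker_claims n p)"
  using assms unfolding maker_claims_def by (auto simp: less_Suc_eq)

lemma maker_claims_snoc:
  assumes "length q = 2 * n"
  shows "maker_claims (Suc n) (q @ x # r) = insert x (maker_claims n q)"
  using assms maker_claims_Suc[of n "q @ x # r"] maker_claims_append[OF assms, of "x # r"]
  by (simp add: nth_append)

lemma follows_snoc:
  "follows \<sigma> (q @ [x]) \<longleftrightarrow> follows \<sigma> q \<and> (even (length q) \<longrightarrow> x = \<sigma> q)"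
  unfolding follows_def by (auto simp: less_Suc_eq nth_append)

text \<open>The winning condition speaks of complete plays only; this makes it applicable to partial
  plays. Breaker's moves are filled in arbitrarily.\<close>

lemma extend_play:
  assumes "finite X" "maker_strategy X \<sigma>" "play X q" "follows \<sigma> q"
  shows "\<exists>r. play X (q @ r) \<and> follows \<sigma> (q @ r) \<and> set (q @ r) = X"
  using assms(3,4)
proof (induction "card (X - set q)" arbitrary: q rule: less_induct)
  case less
  show ?case
  proof (cases "set q = X")
    case True
    then show ?thesis using less.prems by (intro exI[of _ "[]"]) auto
  next
    case False
    then obtain z where z: "z \<in> X - set q"
      using less.prems by (auto simp: play_def)
    define x where "x = (if even (length q) then \<sigma> q else z)"
    have x: "x \<in> X - set q"
      using z False assms(2) less.prems by (auto simp: x_def maker_strategy_def)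
    have q: "play X (q @ [x])" "follows \<sigma> (q @ [x])"
      using less.prems x by (auto simp: play_def follows_snoc x_def)
    have "card (X - set (q @ [x])) < card (X - set q)"
      using x assms(1) by (intro psubset_card_mono) auto
    from less.hyps[OF this q] obtain r where
      "play X ((q @ [x]) @ r) \<and> follows \<sigma> ((q @ [x]) @ r) \<and> set ((q @ [x]) @ r) = X"
      by blast
    then show ?thesis by (intro exI[of _ "x # r"]) auto
  qed
qed

text \<open>Induction on the number \<open>j\<close> of moves left after \<open>n\<close> full
  rounds. At \<open>j = 0\<close> Maker's first \<open>k\<close> claims are already fixed, so any
  completion of \<open>q\<close> exhibits a winning set among them.\<close>

lemma maker_forces_if_wins:
  assumes "finite X" "maker_strategy X \<sigma>"
    and win: "\<And>p. play X p \<Longrightarrow> set p = X \<Longrightarrow> follows \<sigma> p \<Longrightarrow> \<exists>F\<in>W. F \<subseteq> maker_claims k p"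
    and "play X q" "follows \<sigma> q" "length q = 2 * n" "k = n + j"
  shows "maker_forces W j (maker_claims n q) (X - set q)"
  using assms(4-)
proof (induction j arbitrary: n q)
  case 0
  obtain r where "play X (q @ r)" "follows \<sigma> (q @ r)" "set (q @ r) = X"
    using extend_play assms(1,2) 0 by blast
  then have "\<exists>F\<in>W. F \<subseteq> maker_claims k (q @ r)"
    using win by blast
  then show ?case using 0 by (simp add: maker_claims_append)
next
  case (Suc j)
  let ?M = "maker_claims n q"
  show ?case
  proof (cases "set q = X")
    \<comment> \<open>The board ran out early: \<open>q\<close> is itself complete, and its
      \<open>n\<close> rounds hold all of Maker's claims.\<close>
    case True
    then have "\<exists>F\<in>W. F \<subseteq> maker_claims k q"
      using win Suc by blast
    then show ?thesis using Suc.prems maker_claims_short[of q n k] by auto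
  next
    case False
    define x where "x = \<sigma> q"
    have x: "x \<in> X - set q"
      using False assms(2) Suc.prems by (auto simp: x_def maker_strategy_def)
    have q: "play X (q @ [x])" "follows \<sigma> (q @ [x])"
      using Suc.prems x by (auto simp: play_def follows_snoc x_def)
    have reply: "maker_forces W j (insert x ?M) (X - set q - {x, y})"
      if "y \<in> X - set q - {x}" for y
    proof -
      have "maker_forces W j (maker_claims (Suc n) (q @ [x, y])) (X - set (q @ [x, y]))"
        using Suc.prems q that follows_snoc[of \<sigma> "q @ [x]" y]
        by (intro Suc.IH) (auto simp: play_def)
      moreover have "X - set (q @ [x, y]) = X - set q - {x, y}"
        by auto
      ultimately show ?thesis
        using Suc.prems by (simp add: maker_claims_snoc)
    qed
    \<comment> \<open>Passing is not a move of the real game. If an element is still free, claiming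
      it leaves Maker no better off than a pass; otherwise \<open>x\<close> completed the
      play.\<close>
    have pass: "maker_forces W j (insert x ?M) (X - set q - {x})"
    proof (cases "X - set q - {x} = {}")
      case True
      then have "set (q @ [x]) = X"
        using x q by (auto simp: play_def)
      then have "\<exists>F\<in>W. F \<subseteq> maker_claims k (q @ [x])"
        using win q by blast
      moreover have "maker_claims k (q @ [x]) = maker_claims (Suc n) (q @ [x])"
        using Suc.prems by (intro maker_claims_short) auto
      ultimately show ?thesis
        using Suc.prems maker_forces_won by (auto simp: maker_claims_snoc)
    next
      case False
      then obtain y where "y \<in> X - set q - {x}" by blast
      from reply[OF this] show ?thesis
        by (rule maker_forces_mono) auto
    qed
    have "maker_forces W j (insert x ?M) (X - set q - {x, y})" for y
    proof (cases "y \<in> X - set q - {x}")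
      case True
      then show ?thesis by (rule reply)
    next
      case False
      then have "X - set q - {x, y} = X - set q - {x}" by auto
      then show ?thesis using pass by simp
    qed
    then show ?thesis using x by auto
  qed
qed

lemma wins_if_maker_forces:
  assumes "maker_forces W k {} X"
  shows "maker_wins_within X W k"
proof -
  define good where "good q x \<longleftrightarrow> x \<in> X - set q \<and>
      (\<forall>y. maker_forces W (k - Suc (length q div 2))
        (insert x (maker_claims (length q div 2) q)) (X - set q - {x, y}))" for q x
  \<comment> \<open>Any move that keeps the position winning will do. The fallback, any unclaimed
    element, makes legality provable without knowing that a good move exists.\<close>
  define \<sigma> where "\<sigma> q = (if \<exists>x. good q x then SOME x. good q x else SOME x. x \<in> X - set q)" for q
  have good: "good q (\<sigma> q)" if "\<exists>x. good q x" for q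
    using that someI_ex[OF that] by (simp add: \<sigma>_def)
  have "\<sigma> q \<in> X - set q" if "play X q" "set q \<noteq> X" for q
  proof (cases "\<exists>x. good q x")
    case True
    then show ?thesis using good good_def by blast
  next
    case False
    have "\<exists>x. x \<in> X - set q" using that by (auto simp: play_def)
    then have "(SOME x. x \<in> X - set q) \<in> X - set q" by (rule someI_ex)
    then show ?thesis using False by (simp add: \<sigma>_def)
  qed
  then have strategy: "maker_strategy X \<sigma>"
    by (auto simp: maker_strategy_def)
  have "\<exists>F\<in>W. F \<subseteq> maker_claims k p" if p: "play X p" "set p = X" "follows \<sigma> p" for p
  proof -
    \<comment> \<open>Invariant after \<open>n\<close> rounds. It also makes sense if
      \<open>p\<close> ends earlier; no unclaimed element remains then.\<close>
    have "maker_forces W (k - n) (maker_claims n p) (X - set (take (2 * n) p))" if "n \<le> k" for n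
      using that
    proof (induction n)
      case 0
      then show ?case using assms by (simp add: maker_claims_def)
    next
      case (Suc n)
      let ?q = "take (2 * n) p"
      have IH: "maker_forces W (Suc (k - Suc n)) (maker_claims n p) (X - set ?q)"
        using Suc by (simp add: Suc_diff_Suc)
      show ?case
      proof (cases "\<exists>F\<in>W. F \<subseteq> maker_claims n p")
        case True
        moreover have "maker_claims n p \<subseteq> maker_claims (Suc n) p"
          by (auto simp: maker_claims_def)
        ultimately show ?thesis using maker_forces_won by (meson subset_trans)
      next
        case False
        then obtain x where x: "x \<in> X - set ?q"
          "\<And>y. maker_forces W (k - Suc n) (insert x (maker_claims n p)) (X - set ?q - {x, y})"
          using IH by auto
        have len: "2 * n < length p"
          using x(1) p(2) by (metis DiffD1 DiffD2 leI take_all)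
        then have q: "length ?q = 2 * n" by simp
        have claims: "maker_claims n ?q = maker_claims n p"
          using maker_claims_append[OF q, of "drop (2 * n) p"] by simp
        have "good ?q x"
          using x unfolding good_def q by (simp add: claims)
        then have "good ?q (\<sigma> ?q)"
          using good by blast
        moreover have \<sigma>: "\<sigma> ?q = p ! (2 * n)"
          using p(3) len by (simp add: follows_def)
        ultimately have next_position: "maker_forces W (k - Suc n)
            (insert (p ! (2 * n)) (maker_claims n p)) (X - set ?q - {p ! (2 * n), y})" for y
          unfolding good_def q by (simp add: claims)
        \<comment> \<open>Breaker's actual reply; if Maker took the last element, \<open>y\<close>
          repeats her move and so encodes a pass.\<close>
        define y where "y = (if Suc (2 * n) < length p then p ! Suc (2 * n) else p ! (2 * n))"
        have "X - set ?q - {p ! (2 * n), y} = X - set (take (2 * Suc n) p)"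
        proof (cases "Suc (2 * n) < length p")
          case True
          then have "take (2 * Suc n) p = ?q @ [p ! (2 * n), p ! Suc (2 * n)]"
            using len by (simp add: take_Suc_conv_app_nth)
          then show ?thesis using True by (auto simp: y_def)
        next
          case False
          then have "take (2 * Suc n) p = take (Suc (2 * n)) p"
            by simp
          then have last_round: "take (2 * Suc n) p = ?q @ [p ! (2 * n)]"
            using len by (simp only: take_Suc_conv_app_nth)
          show ?thesis unfolding last_round using False by (auto simp: y_def)
        qed
        then show ?thesis
          using next_position[of y] maker_claims_Suc[OF len] by simp
      qed
    qed
    from this[of k] show ?thesis by simp
  qed
  then show ?thesis
    using strategy unfolding maker_wins_within_def by blast
qed

lemma maker_wins_within_iff_forces:
  assumes "finite X"
  shows "maker_wins_within X W k \<longleftrightarrow> maker_forces W k {} X"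
proof
  assume "maker_wins_within X W k"
  then obtain \<sigma> where "maker_strategy X \<sigma>"
    "\<And>p. play X p \<Longrightarrow> set p = X \<Longrightarrow> follows \<sigma> p \<Longrightarrow> \<exists>F\<in>W. F \<subseteq> maker_claims k p"
    unfolding maker_wins_within_def by blast
  from maker_forces_if_wins[OF assms this, of "[]" 0 k] show "maker_forces W k {} X"
    by (simp add: play_def follows_def maker_claims_def)
qed (rule wins_if_maker_forces)

section \<open>Locality of winning positions\<close>

text \<open>Graph distances enter only through \<open>mono\<close>, \<open>triangle\<close> and
  \<open>small\<close>. The bound \<open>card M + j \<le> k\<close> survives every move and limits a
  winning set inside \<open>M\<close> to \<open>k\<close> elements, as \<open>small\<close>
  requires.\<close>

lemma maker_forces_local:
  fixes ball :: "'e \<Rightarrow> nat \<Rightarrow> 'e set"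
  assumes mono: "\<And>c r s. r \<le> s \<Longrightarrow> ball c r \<subseteq> ball c s"
    and triangle: "\<And>c f g r s. \<lbrakk>c \<in> E; f \<in> ball c r; g \<in> ball c s\<rbrakk> \<Longrightarrow> g \<in> ball f (r + s)"
    and small: "\<And>F. \<lbrakk>F \<in> W; F \<subseteq> E; card F \<le> k\<rbrakk> \<Longrightarrow> \<exists>f\<in>F. F \<subseteq> ball f k"
    and "finite E"
    and "maker_forces W j M U" "M \<union> U \<subseteq> E" "card M + j \<le> k"
  shows "\<exists>c\<in>E. maker_forces W j (M \<inter> ball c (2 ^ j * k)) (U \<inter> ball c (2 ^ j * k))"
  using assms(5-)
proof (induction j arbitrary: M U)
  \<comment> \<open>Covers both the base case and a win with moves to spare: radius \<open>k\<close>
    suffices, and \<open>k \<le> 2 ^ j * k\<close>.\<close>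
  have won: "\<exists>c\<in>E. maker_forces W j (M \<inter> ball c (2 ^ j * k)) (U \<inter> ball c (2 ^ j * k))"
    if F: "F \<in> W" "F \<subseteq> M" and M: "M \<subseteq> E" "card M \<le> k" for F j M U
  proof -
    have "card F \<le> k"
      using F M \<open>finite E\<close> card_mono[of M F] finite_subset by fastforce
    then obtain f where f: "f \<in> F" "F \<subseteq> ball f k"
      using small F M by blast
    have "F \<subseteq> M \<inter> ball f (2 ^ j * k)"
      using f F mono[of k "2 ^ j * k" f] by auto
    then show ?thesis
      using f F M maker_forces_won by blast
  qed
  {
    case 0
    then show ?case using won[of _ M 0 U] by auto
  next
    case (Suc j)
    let ?r = "2 ^ j * k"
    show ?case
    proof (cases "\<exists>F\<in>W. F \<subseteq> M")
      case True
      then show ?thesis using won[of _ M "Suc j" U] Suc.prems by auto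
    next
      case False
      then obtain x where x: "x \<in> U" "\<And>y. maker_forces W j (insert x M) (U - {x, y})"
        using Suc.prems by auto
      have "card (insert x M) + j \<le> k"
        using Suc.prems card_insert_le_m1[of "Suc (card M)" M x] by simp
      then have "\<forall>y. \<exists>c\<in>E. maker_forces W j
          (insert x M \<inter> ball c ?r) ((U - {x, y}) \<inter> ball c ?r)"
        using Suc.prems x by (intro allI Suc.IH[OF x(2)]) auto
      then obtain c where c: "\<And>y. c y \<in> E" "\<And>y. maker_forces W j
          (insert x M \<inter> ball (c y) ?r) ((U - {x, y}) \<inter> ball (c y) ?r)"
        by metis
      show ?thesis
      proof (cases "\<forall>y. x \<in> ball (c y) ?r")
        case True
        let ?B = "ball x (2 ^ Suc j * k)"
        \<comment> \<open>Recentring at \<open>x\<close> doubles the radius, and one ball now serves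
          all replies. That \<open>x\<close> lies in it also follows from this inclusion, since
          balls are not assumed to contain their centres.\<close>
        have B: "ball (c y) ?r \<subseteq> ?B" for y
          using triangle[OF c(1)[of y], of x ?r _ ?r] True by (auto simp: mult_2 algebra_simps)
        then have "x \<in> ?B"
          using True by blast
        have "maker_forces W j (insert x (M \<inter> ?B)) (U \<inter> ?B - {x, y})" for y
          by (rule maker_forces_mono[OF c(2)[of y]]) (use B[of y] in auto)
        then have "maker_forces W (Suc j) (M \<inter> ?B) (U \<inter> ?B)"
          using \<open>x \<in> ?B\<close> x by auto
        then show ?thesis using x Suc.prems by blast
      next
        case False
        \<comment> \<open>Intersecting \<open>insert x M\<close> with a ball that misses
          \<open>x\<close> leaves only part of \<open>M\<close>, so Maker wins there without having
          claimed \<open>x\<close>.\<close>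
        then obtain y where y: "x \<notin> ball (c y) ?r" by blast
        have "ball (c y) ?r \<subseteq> ball (c y) (2 ^ Suc j * k)"
          by (rule mono) simp
        then have "maker_forces W j (M \<inter> ball (c y) (2 ^ Suc j * k))
            (U \<inter> ball (c y) (2 ^ Suc j * k))"
          using y by (intro maker_forces_mono[OF c(2)[of y]]) auto
        then show ?thesis using c maker_forces_Suc by blast
      qed
    qed
  }
qed

section \<open>Distances in graphs\<close>

text \<open>Replacing \<open>\<le> r\<close> by \<open>< Suc r\<close> turns the bound on the
  infimum into the existence of a single walk.\<close>

lemma graph_dist_le_iff:
  "graph_dist G u v \<le> enat r \<longleftrightarrow> (\<exists>p. walk_betw G u p v \<and> length p - 1 \<le> r)"
proof -
  have "graph_dist G u v \<le> enat r \<longleftrightarrow> graph_dist G u v < enat (Suc r)"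
    by (cases "graph_dist G u v") auto
  then show ?thesis
    unfolding graph_dist_def INF_less_iff by (auto simp: less_Suc_eq_le)
qed

lemma walk_betw_rev: "walk_betw G u p v \<Longrightarrow> walk_betw G v (rev p) u"
  unfolding walk_betw_def by (auto simp: hd_rev last_rev insert_commute)

lemma walk_betw_trans:
  assumes "walk_betw G u p v" "walk_betw G v q w"
  shows "walk_betw G u (p @ tl q) w"
proof (cases q)
  case (Cons a q')
  then show ?thesis
    using assms by (cases q') (auto simp: walk_betw_def successively_append_iff)
qed (use assms in \<open>simp add: walk_betw_def\<close>)

lemma graph_dist_commute_le: "graph_dist G u v \<le> enat r \<Longrightarrow> graph_dist G v u \<le> enat r"
  unfolding graph_dist_le_iff by (metis walk_betw_rev length_rev)

lemma graph_dist_triangle_le: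
  assumes "graph_dist G u v \<le> enat r" "graph_dist G v w \<le> enat s"
  shows "graph_dist G u w \<le> enat (r + s)"
proof -
  from assms obtain p q where p: "walk_betw G u p v" "length p - 1 \<le> r"
    and q: "walk_betw G v q w" "length q - 1 \<le> s"
    unfolding graph_dist_le_iff by blast
  have "length (p @ tl q) - 1 \<le> r + s"
    using p q by (cases p) (auto simp: walk_betw_def)
  then show ?thesis
    using walk_betw_trans[OF p(1) q(1)] unfolding graph_dist_le_iff by blast
qed

lemma edge_ball_mono:
  assumes "r \<le> s"
  shows "edge_ball G e r \<subseteq> edge_ball G e s"
proof -
  have "d \<le> enat s" if "d \<le> enat r" for d
    using that assms by (cases d) auto
  then show ?thesis
    by (simp add: edge_ball_def subset_iff)
qed

text \<open>Distances are added through a vertex \<open>z\<close> of the centre \<open>c\<close>.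
  For empty \<open>c\<close> every ball would be all of \<open>edges G\<close>.\<close>

lemma edge_ball_triangle:
  assumes "c \<noteq> {}" "f \<in> edge_ball G c r" "g \<in> edge_ball G c s"
  shows "g \<in> edge_ball G f (r + s)"
proof -
  obtain z where z: "z \<in> c" using assms(1) by blast
  have "graph_dist G x y \<le> enat (r + s)" if "x \<in> f" "y \<in> g" for x y
  proof (rule graph_dist_triangle_le)
    show "graph_dist G x z \<le> enat r"
      by (rule graph_dist_commute_le) (use assms(2) z that in \<open>simp add: edge_ball_def\<close>)
    show "graph_dist G z y \<le> enat s"
      using assms(3) z that by (simp add: edge_ball_def)
  qed
  then show ?thesis
    using assms(3) by (simp add: edge_ball_def)
qed

section \<open>Connected edge sets\<close>

text \<open>The stretch between two occurrences of a repeated vertex is cut out, which shortens the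
  list.\<close>

lemma successively_shorten_distinct:
  assumes "successively P p" "p \<noteq> []"
  shows "\<exists>q. distinct q \<and> q \<noteq> [] \<and> hd q = hd p \<and> last q = last p \<and> set q \<subseteq> set p \<and>
    successively P q"
  using assms
proof (induction p rule: length_induct)
  case (1 p)
  show ?case
  proof (cases "distinct p")
    case True
    then show ?thesis using 1 by blast
  next
    case False
    then obtain xs ys zs y where p: "p = xs @ [y] @ ys @ [y] @ zs"
      using not_distinct_decomp by blast
    let ?p = "xs @ [y] @ zs"
    have "successively P ?p"
      using 1(2) unfolding p by (cases zs) (auto simp: successively_append_iff successively_Cons)
    moreover have "length ?p < length p" by (simp add: p)
    ultimately obtain q where q: "distinct q" "q \<noteq> []" "hd q = hd ?p" "last q = last ?p"
      "set q \<subseteq> set ?p" "successively P q"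
      using 1(1) by blast
    moreover have "hd ?p = hd p" "last ?p = last p" "set ?p \<subseteq> set p"
      by (auto simp: p hd_append)
    ultimately show ?thesis by auto
  qed
qed

text \<open>When the vertices are distinct, different steps of the walk use different edges of
  \<open>F\<close>.\<close>

lemma length_distinct_walk_le:
  assumes "finite F" "distinct p" "successively (\<lambda>x y. {x, y} \<in> F) p"
  shows "length p - 1 \<le> card F"
proof -
  let ?e = "\<lambda>i. {p ! i, p ! Suc i}"
  have "inj_on ?e {..<length p - 1}"
  proof (rule inj_onI)
    fix i j
    assume "i \<in> {..<length p - 1}" "j \<in> {..<length p - 1}" "?e i = ?e j"
    then show "i = j"
      using assms(2) by (auto simp: doubleton_eq_iff nth_eq_iff_index_eq)
  qed
  moreover have "?e ` {..<length p - 1} \<subseteq> F"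
    using assms(3) by (auto simp: successively_conv_nth)
  ultimately show ?thesis
    using assms(1) card_inj_on_le[of ?e "{..<length p - 1}" F] by simp
qed

lemma isomorphic_connected_walk:
  assumes "isomorphic K H" "connected_graph H" "u \<in> verts K" "v \<in> verts K"
  shows "\<exists>p. walk_betw K u p v"
proof -
  obtain f where f: "bij_betw f (verts K) (verts H)"
    "\<And>u v. u \<in> verts K \<Longrightarrow> v \<in> verts K \<Longrightarrow> {u, v} \<in> edges K \<longleftrightarrow> {f u, f v} \<in> edges H"
    using assms(1) unfolding isomorphic_def by blast
  let ?g = "the_inv_into (verts K) f"
  have inj: "inj_on f (verts K)" and img: "f ` verts K = verts H"
    using f(1) by (auto simp: bij_betw_def)
  have g: "?g w \<in> verts K" "f (?g w) = w" if "w \<in> verts H" for w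
    using that inj img by (auto intro!: the_inv_into_into f_the_inv_into_f)
  obtain p where p: "walk_betw H (f u) p (f v)"
    using assms(2-4) img unfolding connected_graph_def by blast
  have edge: "{?g x, ?g y} \<in> edges K" if "x \<in> verts H" "y \<in> verts H" "{x, y} \<in> edges H" for x y
    using that g f(2)[of "?g x" "?g y"] by simp
  have "successively (\<lambda>x y. {?g x, ?g y} \<in> edges K) p"
    using p edge unfolding walk_betw_def by (blast intro: successively_mono)
  then have "walk_betw K u (map ?g p) v"
    using p g assms(3,4) the_inv_into_f_f[OF inj]
    by (auto simp: walk_betw_def successively_map hd_map last_map)
  then show ?thesis by blast
qed

text \<open>Two ends of edges of the copy are joined by a path within \<open>F\<close>, hence of
  length at most \<open>card F\<close>, and this path is a walk in \<open>G\<close>. So any edge of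
  \<open>F\<close> can serve as centre.\<close>

lemma connected_copy_in_edge_ball:
  assumes "connected_graph H" "simple_graph G" "finite F" "F \<subseteq> edges G"
    and "isomorphic (edge_induced F) H" "card F \<le> k"
  shows "\<exists>f\<in>F. F \<subseteq> edge_ball G f k"
proof -
  \<comment> \<open>\<open>H\<close> has a vertex, and vertices of \<open>edge_induced F\<close>
    exist only as ends of edges.\<close>
  have "F \<noteq> {}"
    using assms(1,5) by (auto simp: isomorphic_def connected_graph_def edge_induced_def bij_betw_def)
  then obtain f where f: "f \<in> F" by blast
  have "graph_dist G x y \<le> enat k" if xy: "x \<in> \<Union>F" "y \<in> \<Union>F" for x y
  proof -
    obtain p where "walk_betw (edge_induced F) x p y"
      using isomorphic_connected_walk[OF assms(5,1), of x y] xy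
      by (auto simp: edge_induced_def)
    then obtain q where q: "distinct q" "q \<noteq> []" "hd q = x" "last q = y" "set q \<subseteq> \<Union>F"
      "successively (\<lambda>x y. {x, y} \<in> F) q"
      using successively_shorten_distinct[of "\<lambda>x y. {x, y} \<in> F" p]
      by (fastforce simp: walk_betw_def edge_induced_def)
    have "set q \<subseteq> verts G"
      using q(5) assms(2,4) by (auto simp: simple_graph_def)
    moreover have "successively (\<lambda>x y. {x, y} \<in> edges G) q"
      using q(6) assms(4) by (auto elim!: successively_mono)
    moreover have "length q - 1 \<le> k"
      using length_distinct_walk_le[OF assms(3) q(1,6)] assms(6) by simp
    ultimately show ?thesis
      using q unfolding graph_dist_le_iff walk_betw_def by blast
  qed
  then show ?thesis
    using f assms(4) unfolding edge_ball_def by blast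
qed

text \<open>Raising \<open>k\<close> by one multiplies the left side by
  \<open>2 * Suc k / k\<close>, which is at most 3 from \<open>k = 2\<close> on.\<close>

lemma two_power_mult_le_three_power: "2 ^ k * k \<le> (3::nat) ^ k"
proof (induction k)
  case (Suc k)
  show ?case
  proof (cases "k \<le> 1")
    case True
    then have "k = 0 \<or> k = 1" by auto
    then show ?thesis by auto
  next
    case False
    then have "2 ^ k * (2 * Suc k) \<le> 2 ^ k * (3 * k)"
      by (intro mult_left_mono) auto
    also have "\<dots> \<le> 3 * 3 ^ k"
      using Suc by (simp add: algebra_simps)
    finally show ?thesis by (simp add: algebra_simps)
  qed
qed simp

theorem theorem17:
  fixes H :: "'w ugraph" and G :: "'v ugraph" and k :: nat
  assumes "connected_graph H" and "finite_graph G" and "k > 0"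
  shows "maker_wins_graph_game H G k \<longleftrightarrow>
    (\<exists>e\<in>edges G. maker_wins_graph_game H (edge_induced (edge_ball G e (3 ^ k))) k)"
proof -
  let ?B = "\<lambda>e. edge_ball G e (3 ^ k)"
  have simple: "simple_graph G"
    using assms(2) by (simp add: finite_graph_def)
  have fin: "finite (edges G)"
    using assms(2) by (intro finite_subset[of "edges G" "Pow (verts G)"])
      (auto simp: finite_graph_def simple_graph_def)
  have sub: "edge_ball G e r \<subseteq> edges G" for e r
    by (auto simp: edge_ball_def)
  have whole: "maker_wins_graph_game H G k \<longleftrightarrow> maker_forces (winning_sets H G) k {} (edges G)"
    unfolding maker_wins_graph_game_def by (rule maker_wins_within_iff_forces[OF fin])
  \<comment> \<open>An edge set induces the same subgraph in the ball as in \<open>G\<close>, so the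
    winning sets of the ball are those of \<open>G\<close> inside it, and both boards can share one
    family.\<close>
  have part: "maker_wins_graph_game H (edge_induced (?B e)) k \<longleftrightarrow>
      maker_forces (winning_sets H G) k {} (?B e)" for e
  proof -
    have "maker_wins_graph_game H (edge_induced (?B e)) k \<longleftrightarrow>
        maker_forces (winning_sets H (edge_induced (?B e))) k {} (?B e)"
      using maker_wins_within_iff_forces[OF finite_subset[OF sub fin]]
      by (simp add: maker_wins_graph_game_def edge_induced_def)
    also have "\<dots> \<longleftrightarrow> maker_forces (winning_sets H G) k {} (?B e)"
      using sub by (auto elim!: maker_forces_change_sets[where B = "?B e"]
          simp: winning_sets_def edge_induced_def)
    finally show ?thesis .
  qed
  show ?thesis
  proof
    assume "maker_wins_graph_game H G k"
    then have forces: "maker_forces (winning_sets H G) k {} (edges G)"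
      using whole by simp
    have "\<exists>c\<in>edges G. maker_forces (winning_sets H G) k
        ({} \<inter> edge_ball G c (2 ^ k * k)) (edges G \<inter> edge_ball G c (2 ^ k * k))"
    proof (rule maker_forces_local[where ball = "edge_ball G" and E = "edges G",
          OF edge_ball_mono _ _ fin forces])
      fix c f g r s
      assume "c \<in> edges G" and fg: "f \<in> edge_ball G c r" "g \<in> edge_ball G c s"
      then have "c \<noteq> {}"
        using simple by (auto simp: simple_graph_def)
      then show "g \<in> edge_ball G f (r + s)"
        using fg by (rule edge_ball_triangle)
    next
      fix F
      assume "F \<in> winning_sets H G" "F \<subseteq> edges G" "card F \<le> k"
      then show "\<exists>f\<in>F. F \<subseteq> edge_ball G f k"
        using assms(1) simple fin
        by (intro connected_copy_in_edge_ball) (auto simp: winning_sets_def intro: finite_subset)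
    qed auto
    then obtain c where c: "c \<in> edges G" "maker_forces (winning_sets H G) k
        ({} \<inter> edge_ball G c (2 ^ k * k)) (edges G \<inter> edge_ball G c (2 ^ k * k))"
      by blast
    have "maker_forces (winning_sets H G) k {} (?B c)"
      using edge_ball_mono[OF two_power_mult_le_three_power[of k], of G c]
      by (intro maker_forces_mono[OF c(2)]) auto
    then show "\<exists>e\<in>edges G. maker_wins_graph_game H (edge_induced (?B e)) k"
      using c part by blast
  next
    assume "\<exists>e\<in>edges G. maker_wins_graph_game H (edge_induced (?B e)) k"
    then obtain e where "maker_forces (winning_sets H G) k {} (?B e)"
      using part by blast
    \<comment> \<open>With the winning sets shared, Breaker's moves outside the ball are mere
      passes.\<close>
    then have "maker_forces (winning_sets H G) k {} (edges G)"
      by (rule maker_forces_mono) (use sub in auto)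
    then show "maker_wins_graph_game H G k"
      using whole by simp
  qed
qed

end
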